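(* The following system of 12 polynomial equations in the 12 real unknowns $(A,B,C,D,E,F,X,Y,Z,W,\mathcal{C},\mu)\in(\mathbb{R}_{>0})^6\times\mathbb{R}^6$, which describes left-invariant Einstein metrics on $G=S^3\times S^3$ invariant under a subgroup $\mathbb{Z}_2\subset\mathrm{Ad}(G)$, has continuous families of (real) solutions (i.e. there are non-constant continuous maps from an interval of positive length into its set of real solutions): $$\begin{aligned} 0&=ABCDEF-1,\\ 0&=-D+E+F+ABCEF\mu-DX^2+AXYZ-AWX\mathcal{C},\\ 0&=D-E+F+ABCDF\mu-EW^2-EY^2+BXYZ-CWX\mathcal{C},\\ 0&=A-B+C+ACDEF\mu+AW^2-BW^2-BX^2+CX^2-BW^2X^2+EXYZ\\&\quad+AZ^2-BZ^2-BX^2Z^2-FWX\mathcal{C},\\ 0&=D+E-F+ABCDE\mu+CXYZ-FZ^2-BWX\mathcal{C}-F\mathcal{C}^2,\\ 0&=-A+B+C+BCDEF\mu-AW^2+BW^2-AY^2+CY^2+DXYZ-AZ^2+BZ^2\\&\quad-AY^2Z^2-DWX\mathcal{C}+2AWYZ\mathcal{C}-A\mathcal{C}^2+C\mathcal{C}^2-AW^2\mathcal{C}^2,\\ 0&=A+B-C+ABDEF\mu+BX^2-CX^2+AY^2-CY^2-CX^2Y^2+FXYZ-EWX\mathcal{C}\\&\quad+A\mathcal{C}^2-C\mathcal{C}^2-CX^2\mathcal{C}^2,\\ 0&=-ADWX-CEWX-BFWX+A^2WYZ-A^2\mathcal{C}+2AC\mathcal{C}-C^2\mathcal{C}-F^2\mathcal{C}\\&\quad-A^2W^2\mathcal{C}-C^2X^2\mathcal{C},\\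 0&=ADXY+BEXY+CFXY-A^2Z+2ABZ-B^2Z-F^2Z-B^2X^2Z\\&\quad-A^2Y^2Z+A^2WY\mathcal{C},\\ 0&=-A^2Y+2ACY-C^2Y-E^2Y-C^2X^2Y+ADXZ+BEXZ+CFXZ\\&\quad-A^2YZ^2+A^2WZ\mathcal{C},\\ 0&=-A^2W+2ABW-B^2W-E^2W-B^2WX^2-ADX\mathcal{C}-CEX\mathcal{C}-BFX\mathcal{C}\\&\quad+A^2YZ\mathcal{C}-A^2W\mathcal{C}^2,\\ 0&=-B^2X+2BCX-C^2X-D^2X-B^2W^2X-C^2XY^2+ADYZ+BEYZ+CFYZ\\&\quad-B^2XZ^2-ADW\mathcal{C}-CEW\mathcal{C}-BFW\mathcal{C}-C^2X\mathcal{C}^2. \end{aligned}$$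
   Context: $C$ and $\mathcal{C}$ denote two different unknowns; $A,\dots,F$ are positive reals and $X,Y,Z,W,\mathcal{C},\mu$ are arbitrary reals. Origin of the system. Let $Q=-\tfrac12 B_{\mathrm{Kill}}$ on $\mathfrak{g}=\mathfrak{su}(2)\oplus\mathfrak{su}(2)$, where $B_{\mathrm{Kill}}$ is the Killing form, and let $(E_1,E_2,E_3)$, $(F_1,F_2,F_3)$ be oriented $Q$-orthonormal bases of the two factors. The unknowns parametrize the left-invariant metric $g$ on $G=S^3\times S^3$ with orthonormal basis $aE_1,\ bE_2,\ cE_3,\ xE_1+dF_1,\ yE_2+wE_3+eF_2,\ \gamma E_2+zE_3+fF_3$, where $a=\sqrt{BC}$, $b=\sqrt{AC}$, $c=\sqrt{AB}$, $d=\sqrt{EF}$, $e=\sqrt{DF}$, $f=\sqrt{DE}$, $x=X\sqrt{BC}$, $y=Y\sqrt{AC}$, $z=Z\sqrt{AB}$, $w=W\sqrt{AB}$, $\gamma=\mathcal{C}\sqrt{AC}$. The system is $\nabla S=\mu\nabla V$, $V=1$, where $S$ is the scalar curvature of $g$, $V=(ABCDEF)^{-1}$ is its volume relative to that of $Q$, $\nabla$ is the gradient in the coordinates $(A,\dots,F,X,Y,Z,W,\mathcal{C})$, and $\mu$ is a Lagrange multiplier. *)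

theory Defs
  imports "HOL-Analysis.Analysis"
begin

text \<open>
  The variable \<open>Ca\<close> is the calligraphic C of the system, which is an unknown different from \<open>C\<close>.
  The system is \<open>\<nabla>S = \<mu> \<nabla>V\<close>, \<open>V = 1\<close> in the coordinates \<open>(A,\<dots>,F,X,Y,Z,W,Ca)\<close>, with
  \<open>S\<close> the scalar curvature and \<open>V = 1 / (A B C D E F)\<close> the relative volume of the left-invariant
  metric on \<open>S\<^sup>3 \<times> S\<^sup>3\<close> that has the orthonormal basis
  \<open>a E1, b E2, c E3, x E1 + d F1, y E2 + w E3 + e F2, \<gamma> E2 + z E3 + f F3\<close>, where
  \<open>a = sqrt (B C)\<close>, \<open>b = sqrt (A C)\<close>, \<open>c = sqrt (A B)\<close>, \<open>d = sqrt (E F)\<close>, \<open>e = sqrt (D F)\<close>,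
  \<open>f = sqrt (D E)\<close>, \<open>x = X a\<close>, \<open>y = Y b\<close>, \<open>z = Z c\<close>, \<open>w = W c\<close>, \<open>\<gamma> = Ca b\<close>.
  Here \<open>E1, E2, E3\<close> and \<open>F1, F2, F3\<close> are oriented bases of the two factors of
  \<open>su(2) \<oplus> su(2)\<close> that are orthonormal for \<open>- 1/2\<close> times the Killing form.
\<close>

definition einstein_system ::
  "real \<Rightarrow> real \<Rightarrow> real \<Rightarrow> real \<Rightarrow> real \<Rightarrow> real \<Rightarrow> real \<Rightarrow> real \<Rightarrow> real \<Rightarrow> real \<Rightarrow> real \<Rightarrow> real \<Rightarrow> bool"
where
  "einstein_system A B C D E F X Y Z W Ca \<mu> \<longleftrightarrow>
    0 = A*B*C*D*E*F - 1 \<and>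
    0 = - D + E + F + A*B*C*E*F*\<mu> - D*X^2 + A*X*Y*Z - A*W*X*Ca \<and>
    0 = D - E + F + A*B*C*D*F*\<mu> - E*W^2 - E*Y^2 + B*X*Y*Z - C*W*X*Ca \<and>
    0 = A - B + C + A*C*D*E*F*\<mu> + A*W^2 - B*W^2 - B*X^2 + C*X^2 - B*W^2*X^2 + E*X*Y*Z
        + A*Z^2 - B*Z^2 - B*X^2*Z^2 - F*W*X*Ca \<and>
    0 = D + E - F + A*B*C*D*E*\<mu> + C*X*Y*Z - F*Z^2 - B*W*X*Ca - F*Ca^2 \<and>
    0 = - A + B + C + B*C*D*E*F*\<mu> - A*W^2 + B*W^2 - A*Y^2 + C*Y^2 + D*X*Y*Z - A*Z^2 + B*Z^2
        - A*Y^2*Z^2 - D*W*X*Ca + 2*A*W*Y*Z*Ca - A*Ca^2 + C*Ca^2 - A*W^2*Ca^2 \<and>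
    0 = A + B - C + A*B*D*E*F*\<mu> + B*X^2 - C*X^2 + A*Y^2 - C*Y^2 - C*X^2*Y^2 + F*X*Y*Z - E*W*X*Ca
        + A*Ca^2 - C*Ca^2 - C*X^2*Ca^2 \<and>
    0 = - A*D*W*X - C*E*W*X - B*F*W*X + A^2*W*Y*Z - A^2*Ca + 2*A*C*Ca - C^2*Ca - F^2*Ca
        - A^2*W^2*Ca - C^2*X^2*Ca \<and>
    0 = A*D*X*Y + B*E*X*Y + C*F*X*Y - A^2*Z + 2*A*B*Z - B^2*Z - F^2*Z - B^2*X^2*Z
        - A^2*Y^2*Z + A^2*W*Y*Ca \<and>
    0 = - (A^2*Y) + 2*A*C*Y - C^2*Y - E^2*Y - C^2*X^2*Y + A*D*X*Z + B*E*X*Z + C*F*X*Z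
        - A^2*Y*Z^2 + A^2*W*Z*Ca \<and>
    0 = - (A^2*W) + 2*A*B*W - B^2*W - E^2*W - B^2*W*X^2 - A*D*X*Ca - C*E*X*Ca - B*F*X*Ca
        + A^2*Y*Z*Ca - A^2*W*Ca^2 \<and>
    0 = - (B^2*X) + 2*B*C*X - C^2*X - D^2*X - B^2*W^2*X - C^2*X*Y^2 + A*D*Y*Z + B*E*Y*Z + C*F*Y*Z
        - B^2*X*Z^2 - A*D*W*Ca - C*E*W*Ca - B*F*W*Ca - C^2*X*Ca^2"

definition einstein_solutions ::
  "(real \<times> real \<times> real \<times> real \<times> real \<times> real \<times> real \<times> real \<times> real \<times> real \<times> real \<times> real) set"
where
  "einstein_solutions = {(A, B, C, D, E, F, X, Y, Z, W, Ca, \<mu>).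
    A > 0 \<and> B > 0 \<and> C > 0 \<and> D > 0 \<and> E > 0 \<and> F > 0 \<and> einstein_system A B C D E F X Y Z W Ca \<mu>}"

end

theory Submission
  imports Defs
begin

text \<open>
  At \<open>\<theta> = 0\<close> the curve below is the metric with orthonormal basis \<open>E\<^sub>i, E\<^sub>i + F\<^sub>i\<close>. It is Einstein,
  being the pullback of the bi-invariant product metric under the diffeomorphism
  \<open>(g, h) \<mapsto> (g h\<^sup>-\<^sup>1, h)\<close>, and it is left-invariant because this map turns left translations
  into isometries of the product.
  The automorphisms \<open>Ad(exp(\<theta> E\<^sub>1), 1)\<close> rotate \<open>E\<^sub>2, E\<^sub>3\<close> while fixing the second factor. Pulling the
  metric back along them preserves the Einstein condition and moves it along a circle in the
  coordinates \<open>Y, Z, W, Ca\<close>.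
\<close>

text \<open>Substituting turns each right-hand side into a (possibly zero) multiple of
  \<open>c\<^sup>2 + s\<^sup>2 - 1\<close>; the sixth, for instance, is \<open>u - u\<^sup>2\<close>
  with \<open>u = c\<^sup>2 + s\<^sup>2\<close>. The multiplier is forced: the third equation
  reduces to \<open>1 + \<mu> = 0\<close>.\<close>

lemma einstein_system_rotation:
  fixes c s :: real
  assumes "c\<^sup>2 + s\<^sup>2 = 1"
  shows "einstein_system 1 1 1 1 1 1 1 c c s (- s) (- 1)"
  unfolding einstein_system_def
  by (intro conjI; simp add: power2_eq_square;
      use assms[unfolded power2_eq_square] in \<open>algebra\<close>)

theorem proposition3:
  shows "\<exists>(s::real) t p. s < t \<and> continuous_on {s..t} p \<and> p ` {s..t} \<subseteq> einstein_solutions \<and>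
    \<not> p constant_on {s..t}"
proof -
  define p :: "real \<Rightarrow> real \<times> real \<times> real \<times> real \<times> real \<times> real \<times> real \<times> real \<times> real \<times> real \<times> real \<times> real"
    where "p \<theta> = (1, 1, 1, 1, 1, 1, 1, cos \<theta>, cos \<theta>, sin \<theta>, - sin \<theta>, - 1)" for \<theta>
  have "continuous_on {0..pi} p"
    unfolding p_def by (intro continuous_intros)
  moreover have "p ` {0..pi} \<subseteq> einstein_solutions"
    by (auto simp: p_def einstein_solutions_def einstein_system_rotation)
  \<comment> \<open>On a half circle the endpoints already differ, since \<open>cos\<close> goes
    from 1 to -1; a full turn would close up.\<close>
  moreover have "p 0 \<noteq> p pi"
    by (simp add: p_def)
  then have "\<not> p constant_on {0..pi}"
    unfolding constant_on_def by (metis atLeastAtMost_iff order_refl pi_ge_zero)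
  ultimately show ?thesis
    using pi_gt_zero by blast
qed

end
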